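(* Let $q$ be a complex number with $0<|q|<1$. For every integer $n\ge 0$ and every complex number $y$ not of the form $-q^{-m}$ with $m\ge 0$ an integer, the following identities are valid. (a) $$\sum_{k=0}^n q^k\frac{(yq^{n};q)_k}{(q^2;q^2)_k}=(-y;q)_n\sum_{k=0}^{n}q^k\frac{(y/q;q)_{2k}}{(q^2;q^2)_k\,(y^2;q^2)_k}.$$ (b) $$\sum_{k=0}^n\begin{bmatrix}n\\k\end{bmatrix}_q y^kq^{k^2/2-k/2}\frac{(q;q)_k}{(yq^{n};q)_{k+1}}=\frac{(q^2;q^2)_n\,(y^2;q^2)_n}{(y;q)_{2n+1}}\sum_{k=0}^{n} q^{2k}\frac{(y/q;q)_{2k}}{(q^2;q^2)_k\,(y^2;q^2)_k}.$$ (c) In particular, $$\sum_{k=0}^\infty y^kq^{k^2/2-k/2}=(q^2;q^2)_\infty\,(-y;q)_\infty\;{}_2\phi_1\!\left[\begin{matrix}y/q,\;y\\ y^2\end{matrix};q^2,q^2\right],$$ (d) while, for any integer $r\ge 0$, $$(-q;q)_{2r}\sum_{k=0}^\infty q^{k^2/2+k/2+2rk}=\frac{(q^2;q^2)_\infty}{(q;q^2)_\infty}\sum_{k=0}^{\infty} q^{2k}\frac{(q^{2r};q)_{2k}}{(q^2;q^2)_k\,(q^{4r+2};q^2)_k}.$$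
   Context: For $|p|<1$: $(x;p)_\infty=\prod_{i=0}^\infty(1-xp^i)$ and, for integers $n\ge 0$, $(x;p)_n=\prod_{i=0}^{n-1}(1-xp^i)$ (empty product equal to $1$). The $q$-binomial coefficient is $\begin{bmatrix}n\\k\end{bmatrix}_q=\frac{(q;q)_n}{(q;q)_{n-k}(q;q)_k}$. The basic hypergeometric series with base $p$ and argument $x$ is ${}_2\phi_1\!\left[\begin{matrix}a,b\\ c\end{matrix};p,x\right]=\sum_{k=0}^\infty\frac{(a;p)_k(b;p)_k}{(p;p)_k(c;p)_k}x^k$.
   Formalization: The right sides of (a), (b), (c) are read as values by continuity in y, since they are 0/0 at some y = q^{-m}; in (b) the points y = q^{-m} with n ≤ m ≤ 2n are excluded, because there the denominators (yq^n;q)_{k+1} and (y;q)_{2n+1} vanish. *)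

theory Defs
  imports "HOL-Complex_Analysis.Complex_Analysis"
begin

definition qpoch :: "complex \<Rightarrow> complex \<Rightarrow> nat \<Rightarrow> complex" where
  "qpoch x p n = (\<Prod>i<n. 1 - x * p ^ i)"

definition qpoch_inf :: "complex \<Rightarrow> complex \<Rightarrow> complex" where
  "qpoch_inf x p = (\<Prod>i. 1 - x * p ^ i)"

definition qbinom :: "complex \<Rightarrow> nat \<Rightarrow> nat \<Rightarrow> complex" where
  "qbinom q n k = qpoch q q n / (qpoch q q (n - k) * qpoch q q k)"

definition phi21 :: "complex \<Rightarrow> complex \<Rightarrow> complex \<Rightarrow> complex \<Rightarrow> complex \<Rightarrow> complex" where
  "phi21 a b c p x =
     (\<Sum>k. qpoch a p k * qpoch b p k / (qpoch p p k * qpoch c p k) * x ^ k)"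

text \<open>
  Pitfall. The quotients \<open>(y/q;q)\<^sub>2\<^sub>k / (y\<^sup>2;q\<^sup>2)\<^sub>k\<close> and
  \<open>(y\<^sup>2;q\<^sup>2)\<^sub>n / (y;q)\<^sub>2\<^sub>n\<^sub>+\<^sub>1\<close> read \<open>0/0\<close> at some of the points
  \<open>y = 1, 1/q, 1/q\<^sup>2, \<dots>\<close>: the common factors \<open>1 - y q\<^sup>j\<close> have to be cancelled there,
  whereas division by zero in HOL returns \<open>0\<close>. Right-hand sides containing these quotients
  are therefore written as \<^term>\<open>remove_sings F y\<close> with the literal formula as \<^term>\<open>F\<close>.
  Where \<^term>\<open>F\<close> is analytic, this is just \<^term>\<open>F y\<close> (\<open>remove_sings_at_analytic\<close>).
\<close>

end

theory Submission
  imports Defs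
begin

text \<open>
  Both sides of (a) satisfy a first-order recurrence in \<open>n\<close>. On the right-hand side the sum gains one
  term and the prefactor gains \<open>1 + y q\<^sup>n\<close>; on the left-hand side the same recurrence holds because
  the difference of the two sums telescopes. Identity (b) is proved in the same way, with the
  telescoping supplied by a Wilf--Zeilberger certificate. Letting \<open>n\<close> tend to infinity in (b), by
  Tannery's theorem, gives (c), and (d) is the case \<open>y = q\<^bsup>2r+1\<^esup>\<close> of (c) combined with Euler's
  \<open>(-q;q)\<^sub>\<infinity> (q;q\<^sup>2)\<^sub>\<infinity> = 1\<close>. All identities are first shown away from the points \<open>y = \<plusminus>q\<^bsup>-m\<^esup>\<close>;
  these have no finite accumulation point and the left-hand sides are continuous, so that the
  singularities of the right-hand sides are removable with the expected value.
\<close>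

section \<open>Finite q-Pochhammer symbols and the recurrence behind (a)\<close>

lemma qpoch_0 [simp]: "qpoch x p 0 = 1"
  by (simp add: qpoch_def)

lemma qpoch_Suc: "qpoch x p (Suc n) = qpoch x p n * (1 - x * p ^ n)"
  by (simp add: qpoch_def)

lemma qpoch_add: "qpoch x p (m + n) = qpoch x p m * qpoch (x * p ^ m) p n"
  by (induction n) (simp_all add: qpoch_Suc power_add mult_ac)

lemma qpoch_Suc_left: "qpoch x p (Suc n) = (1 - x) * qpoch (x * p) p n"
  using qpoch_add[of x p 1 n] by (simp add: qpoch_Suc)

lemma qpoch_double: "qpoch x p (2 * n) = qpoch x (p\<^sup>2) n * qpoch (x * p) (p\<^sup>2) n"
  by (induction n) (simp_all add: qpoch_Suc power_mult [symmetric] mult_ac)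

lemma qpoch_square: "qpoch (x\<^sup>2) (p\<^sup>2) n = qpoch x p n * qpoch (- x) p n"
proof (induction n)
  case (Suc n)
  have "1 - x\<^sup>2 * (p\<^sup>2) ^ n = (1 - x * p ^ n) * (1 - (- x) * p ^ n)"
    by (simp add: algebra_simps power2_eq_square power_mult_distrib)
  with Suc show ?case by (simp add: qpoch_Suc mult_ac)
qed simp

lemma qpoch_eq_0_iff: "qpoch x p n = 0 \<longleftrightarrow> (\<exists>i<n. x * p ^ i = 1)"
  by (auto simp: qpoch_def)

lemma power_ne_one:
  fixes q :: complex
  assumes "norm q < 1" "0 < k"
  shows "q ^ k \<noteq> 1"
proof
  assume "q ^ k = 1"
  then have "norm q ^ k = 1" by (metis norm_one norm_power)
  with assms show False by (metis norm_ge_zero order_less_irrefl power_less_one_iff)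
qed

lemma qpoch_self_nonzero:
  assumes "norm q < 1"
  shows "qpoch q q n \<noteq> 0"
  using power_ne_one[OF assms, of "Suc _"] by (auto simp: qpoch_eq_0_iff)

text \<open>For w = z q^n and N = n this is the recurrence in n of the left-hand side of (a), and
  the right-hand side is the term that the other side gains. Keeping N independent of w lets the
  induction run over the summation range with w fixed.\<close>

lemma sum_qpoch_telescope:
  assumes q: "norm q < 1"
  shows "(\<Sum>k\<le>Suc N. q ^ k * (qpoch (q * w) q k / qpoch (q\<^sup>2) (q\<^sup>2) k))
       - (1 + w) * (\<Sum>k\<le>N. q ^ k * (qpoch w q k / qpoch (q\<^sup>2) (q\<^sup>2) k))
       = (q ^ Suc N - w) * qpoch (q * w) q N / qpoch (q\<^sup>2) (q\<^sup>2) (Suc N)"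
proof (induction N)
  case 0
  have "1 - q\<^sup>2 \<noteq> 0" using power_ne_one[OF q, of 2] by simp
  then show ?case by (simp add: qpoch_Suc divide_simps) (simp add: algebra_simps power2_eq_square)
next
  case (Suc N)
  define P where "P = qpoch (q\<^sup>2) (q\<^sup>2) (Suc N)"
  define D where "D = 1 - q\<^sup>2 * (q\<^sup>2) ^ Suc N"
  define A where "A = qpoch (q * w) q N"
  have "norm (q\<^sup>2) < 1" using q by (simp add: norm_power power_less_one_iff)
  from qpoch_self_nonzero[OF this] have "P \<noteq> 0" "P * D \<noteq> 0"
    unfolding P_def D_def by (metis qpoch_Suc)+
  then have nz: "P \<noteq> 0" "D \<noteq> 0" by auto
  \<comment> \<open>The first sum gains its term k = N + 2 and the second its term k = N + 1. All
    Pochhammer numerators are multiples of \<open>A\<close>, notably (w;q)_{N+1} = (1 - w) A; with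
    \<open>A / (P * D)\<close> factored out, a polynomial identity in q, w and q^N remains.\<close>
  have "(q ^ Suc N - w) * A / P + q ^ Suc (Suc N) * (A * (1 - q * w * q ^ N) * (1 - q * w * q ^ Suc N) / (P * D))
      - (1 + w) * (q ^ Suc N * ((1 - w) * A / P))
      = (q ^ Suc (Suc N) - w) * (A * (1 - q * w * q ^ N)) / (P * D)"
  proof -
    have "((q ^ Suc N - w) - (1 + w) * q ^ Suc N * (1 - w)) * D + q ^ Suc (Suc N) * ((1 - q * w * q ^ N) * (1 - q * w * q ^ Suc N))
       = (q ^ Suc (Suc N) - w) * (1 - q * w * q ^ N)"
      unfolding D_def power_commutes[symmetric] power_Suc power2_eq_square power_mult_distrib
      by algebra
    moreover have "(q ^ Suc N - w) * A / P + q ^ Suc (Suc N) * (A * (1 - q * w * q ^ N) * (1 - q * w * q ^ Suc N) / (P * D))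
      - (1 + w) * (q ^ Suc N * ((1 - w) * A / P))
      = A * (((q ^ Suc N - w) - (1 + w) * q ^ Suc N * (1 - w)) * D
          + q ^ Suc (Suc N) * ((1 - q * w * q ^ N) * (1 - q * w * q ^ Suc N))) / (P * D)"
      using nz by (simp add: divide_simps) (simp add: algebra_simps)
    ultimately show ?thesis by (simp only: mult_ac)
  qed
  then show ?case
    using Suc.IH unfolding sum.atMost_Suc[of _ "Suc N"] sum.atMost_Suc[of "\<lambda>k. q ^ k * (qpoch w q k / qpoch (q\<^sup>2) (q\<^sup>2) k)" N]
      distrib_left qpoch_Suc_left[of w q N] mult.commute[of w q]
      qpoch_Suc[of _ _ "Suc N"] 
    unfolding P_def[symmetric] D_def[symmetric] qpoch_Suc[of "q*w" q N] A_def[symmetric]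
    by (simp add: algebra_simps)
qed

section \<open>Recurrence for the left-hand side of (b)\<close>

text \<open>
  For \<open>Q = q\<^sup>n\<close> this is the summand on the left-hand side of (b) (lemma \<open>qbinom_eq_rogers_term\<close>), written
  so that it vanishes for \<open>k > n\<close> and makes sense for all \<open>k\<close>.
\<close>
definition rogers_term :: "complex \<Rightarrow> complex \<Rightarrow> complex \<Rightarrow> nat \<Rightarrow> complex" where
  "rogers_term q y Q k = y ^ k * (\<Prod>j<k. q ^ j - Q) / qpoch (y * Q) q (Suc k)"

lemma rogers_term_Suc:
  "rogers_term q y Q (Suc k) = rogers_term q y Q k * (y * (q ^ k - Q) / (1 - y * Q * q ^ Suc k))"
  by (simp add: rogers_term_def qpoch_Suc[of _ _ "Suc k"] del: power_Suc) (simp add: mult_ac)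

lemma rogers_term_eq_0: "n < k \<Longrightarrow> rogers_term q y (q ^ n) k = 0"
  by (auto simp: rogers_term_def)

text \<open>Because q^(j+1) - q R = q (q^j - R), replacing R by q R shifts the index of the
  numerator factors by one. The denominator factors 1 - y R q^i shift likewise, so only the factors
  at the two ends differ.\<close>

lemma rogers_term_shift:
  assumes "q \<noteq> 0" "y * R \<noteq> 1" "\<And>m. y * (q * R) * q ^ m \<noteq> 1"
  shows "(1 - q * R) * (1 - y * R) * rogers_term q y R k
       = (1 - q * R / q ^ k) * (1 - y * (q * R) * q ^ k) * rogers_term q y (q * R) k"
proof -
  have nz: "1 - y * (q * R) * q ^ k \<noteq> 0" "1 - y * R \<noteq> 0" "qpoch (y * (q * R)) q (Suc k) \<noteq> 0"
    using assms(3)[of k] assms(2,3) by (auto simp: qpoch_eq_0_iff)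
  have *: "(1 - q * R) * (\<Prod>j<k. q ^ j - R) = (1 - q * R / q ^ k) * (\<Prod>j<k. q ^ j - q * R)"
  proof (induction k)
    case (Suc k)
    have "(1 - q * R) * (\<Prod>j<Suc k. q ^ j - R) = (1 - q * R / q ^ k) * (\<Prod>j<k. q ^ j - q * R) * (q ^ k - R)"
      using Suc by simp
    also have "\<dots> = (1 - q * R / q ^ Suc k) * (\<Prod>j<Suc k. q ^ j - q * R)"
      using assms(1) by (simp add: field_simps)
    finally show ?case .
  qed simp
  have "(1 - y * R) * qpoch (y * (q * R)) q (Suc k) = qpoch (y * R) q (Suc k) * (1 - y * (q * R) * q ^ k)"
    using qpoch_Suc_left[of "y * R" q "Suc k"] qpoch_Suc[of "y * R" q "Suc k"] by (simp add: mult_ac)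
  then have den: "qpoch (y * R) q (Suc k) = (1 - y * R) * qpoch (y * (q * R)) q (Suc k) / (1 - y * (q * R) * q ^ k)"
    using nz by (simp add: field_simps)
  have "(1 - q * R) * (1 - y * R) * rogers_term q y R k
     = y ^ k * ((1 - q * R) * (\<Prod>j<k. q ^ j - R)) * (1 - y * R) / qpoch (y * R) q (Suc k)"
    by (simp add: rogers_term_def mult_ac)
  also have "\<dots> = y ^ k * ((1 - q * R) * (\<Prod>j<k. q ^ j - R)) * (1 - y * (q * R) * q ^ k) / qpoch (y * (q * R)) q (Suc k)"
    unfolding den using nz by simp
  also have "\<dots> = (1 - q * R / q ^ k) * (1 - y * (q * R) * q ^ k) * rogers_term q y (q * R) k"
    unfolding * by (simp add: rogers_term_def mult_ac)
  finally show ?thesis .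
qed

text \<open>
  The coefficients are those of the recurrence in \<open>rogers_sum_rec\<close>, after expressing the summand at
  \<open>R = q\<^sup>n\<close> through the one at \<open>Q = q\<^bsup>n+1\<^esup>\<close> by \<open>rogers_term_shift\<close>. The certificate \<open>(1 - y Q K) c\<close>
  was found as the solution of the form \<open>(1 - y Q K) (\<alpha> + \<beta> / K)\<close>, where \<open>K = q\<^sup>k\<close>.
\<close>
lemma rogers_term_telescope:
  fixes q y R :: complex
  assumes "q \<noteq> 0" "\<And>m. y * (q * R) * q ^ m \<noteq> 1"
  defines "Q \<equiv> q * R"
  defines "c \<equiv> \<lambda>k. (1 + y * R) * Q - (1 + Q) * Q / q ^ k"
  shows "(\<Sum>k<N. ((1 - y * Q * R) * (1 - y * Q\<^sup>2)
             - (1 + Q) * (1 + y * R) * (1 - Q / q ^ k) * (1 - y * Q * q ^ k)) * rogers_term q y Q k)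
       = (1 - y * Q * q ^ N) * c N * rogers_term q y Q N + Q * R * (q - y)"
proof (induction N)
  case 0
  \<comment> \<open>The term k = 0 is 1 / (1 - y Q), so the certificate contributes c 0 = Q R (y -
    q). The added constant Q R (q - y) is there to cancel it.\<close>
  have "1 - y * Q \<noteq> 0" using assms(2)[of 0] by (simp add: Q_def)
  then show ?case by (simp add: c_def rogers_term_def qpoch_Suc) (simp add: Q_def algebra_simps)
next
  case (Suc N)
  define K where "K = q ^ N"
  have nz: "K \<noteq> 0" "1 - y * Q * (q * K) \<noteq> 0"
    using assms(1) assms(2)[of "Suc N"] by (auto simp: K_def Q_def)
  have r: "(1 - y * Q * (q * K)) * rogers_term q y Q (Suc N) = y * (K - Q) * rogers_term q y Q N"
    using nz by (simp add: rogers_term_Suc K_def)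
  have c: "c N = (1 + y * R) * Q - (1 + Q) * Q / K" "c (Suc N) = (1 + y * R) * Q - (1 + Q) * R / K"
    using assms(1) by (simp_all add: c_def K_def Q_def)
  have "(1 - y * Q * K) * c N + ((1 - y * Q * R) * (1 - y * Q\<^sup>2)
             - (1 + Q) * (1 + y * R) * (1 - Q / K) * (1 - y * Q * K)) = c (Suc N) * (y * (K - Q))"
    using nz(1) unfolding c by (simp add: divide_simps) (simp add: Q_def algebra_simps power2_eq_square)
  then have "((1 - y * Q * K) * c N + ((1 - y * Q * R) * (1 - y * Q\<^sup>2)
             - (1 + Q) * (1 + y * R) * (1 - Q / K) * (1 - y * Q * K))) * rogers_term q y Q N
      = c (Suc N) * ((1 - y * Q * (q * K)) * rogers_term q y Q (Suc N))"
    unfolding r by simp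
  note step = this[unfolded K_def, folded power_Suc]
  have combine: "X * t + E + B * t = W * c' * t' + E" if "(X + B) * t = c' * (W * t')"
    for X t E B W c' t' :: complex
    using that by (simp add: algebra_simps)
  show ?case unfolding sum.lessThan_Suc Suc.IH by (rule combine[OF step])
qed

text \<open>The coefficients are chosen to fit the right-hand side of (b): their quotient is the
  ratio of consecutive prefactors, and the inhomogeneous term is the contribution of the new summand
  k = n + 1.\<close>

lemma rogers_sum_rec:
  assumes "q \<noteq> 0" "\<And>m. y * q ^ m \<noteq> 1"
  shows "(1 - y * q ^ (2 * n + 1)) * (1 - y * q ^ (2 * n + 2)) * (\<Sum>k\<le>Suc n. rogers_term q y (q ^ Suc n) k)
       = (1 - q ^ (2 * n + 2)) * (1 - y\<^sup>2 * q ^ (2 * n)) * (\<Sum>k\<le>n. rogers_term q y (q ^ n) k)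
         + q ^ (2 * n + 1) * (q - y)"
proof -
  define R where "R = q ^ n"
  define Q where "Q = q * R"
  have QR: "q ^ (2 * n + 1) = Q * R" "q ^ (2 * n + 2) = Q\<^sup>2" "q ^ (2 * n) = R\<^sup>2" "q ^ n = R" "q ^ Suc n = Q"
    by (simp_all add: Q_def R_def power_add mult_2 power2_eq_square)
  have ne: "y * (q * R) * q ^ m \<noteq> 1" for m
    using assms(2)[of "Suc n + m"] by (simp add: R_def power_add mult_ac)
  have ne': "y * R \<noteq> 1" using assms(2)[of n] by (simp add: R_def)
  note shift = rogers_term_shift[OF assms(1) ne' ne, folded Q_def]
  \<comment> \<open>The first zero removes the upper boundary term of the telescoping sum; the
    second lets the sum for \<open>R\<close> run to \<open>Suc n\<close> as well.\<close>
  have zero: "rogers_term q y Q (Suc (Suc n)) = 0" "rogers_term q y R (Suc n) = 0"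
    using rogers_term_eq_0[of "Suc n" "Suc (Suc n)" q y] rogers_term_eq_0[of n "Suc n" q y]
    unfolding QR by simp_all
  have "(1 - Q\<^sup>2) * (1 - y\<^sup>2 * R\<^sup>2) * (\<Sum>k\<le>n. rogers_term q y R k)
      = (1 - Q\<^sup>2) * (1 - y\<^sup>2 * R\<^sup>2) * (\<Sum>k\<le>Suc n. rogers_term q y R k)"
    using zero by simp
  \<comment> \<open>Factoring both differences of squares exposes the factor (1 - Q) (1 - y R) to
    which \<open>shift\<close> applies.\<close>
  also have "\<dots> = (\<Sum>k\<le>Suc n. (1 + Q) * (1 + y * R) * ((1 - Q) * (1 - y * R) * rogers_term q y R k))"
    unfolding sum_distrib_left by (intro sum.cong refl) (simp add: algebra_simps power2_eq_square)
  also have "\<dots> = (\<Sum>k\<le>Suc n. (1 + Q) * (1 + y * R) * ((1 - Q / q ^ k) * (1 - y * Q * q ^ k) * rogers_term q y Q k))"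
    by (simp only: shift)
  finally have scaled: "(1 - Q\<^sup>2) * (1 - y\<^sup>2 * R\<^sup>2) * (\<Sum>k\<le>n. rogers_term q y R k)
    = (\<Sum>k\<le>Suc n. (1 + Q) * (1 + y * R) * ((1 - Q / q ^ k) * (1 - y * Q * q ^ k) * rogers_term q y Q k))" .
  have collect: "a * b * t - e * f * (g * h * t) = (a * b - e * f * g * h) * t" for a b e f g h t :: complex
    by (simp add: algebra_simps)
  have "(1 - y * (Q * R)) * (1 - y * Q\<^sup>2) * (\<Sum>k\<le>Suc n. rogers_term q y Q k)
      - (1 - Q\<^sup>2) * (1 - y\<^sup>2 * R\<^sup>2) * (\<Sum>k\<le>n. rogers_term q y R k)
    = (\<Sum>k\<le>Suc n. ((1 - y * Q * R) * (1 - y * Q\<^sup>2)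
             - (1 + Q) * (1 + y * R) * (1 - Q / q ^ k) * (1 - y * Q * q ^ k)) * rogers_term q y Q k)"
    unfolding scaled unfolding sum_distrib_left sum_subtractf[symmetric] collect by (simp only: mult.assoc)
  also have "\<dots> = Q * R * (q - y)"
    using rogers_term_telescope[OF assms(1) ne, of "Suc (Suc n)", folded Q_def] zero
    by (simp add: lessThan_Suc_atMost)
  finally show ?thesis unfolding QR by (simp only: diff_eq_eq add.commute)
qed

text \<open>This drives every induction on the exponent k^2/2 - k/2. At k = 0 the truncated
  \<open>k - 1\<close> is multiplied by 0, so the encoding is still correct.\<close>

lemma theta_index_Suc: "Suc k * (Suc k - 1) div 2 = k * (k - 1) div 2 + k" for k :: nat
  by (cases k) (simp_all add: field_simps)

text \<open>Writing q^j - q^n = q^j (1 - q^(n-j)) turns the product over j < k into q^(k(k-1)/2)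
  (q;q)_n / (q;q)_{n-k}; the factor (q;q)_k cancels against the q-binomial.\<close>

lemma qbinom_eq_rogers_term:
  assumes "norm q < 1" "k \<le> n"
  shows "qbinom q n k * y ^ k * q ^ (k * (k - 1) div 2) * (qpoch q q k / qpoch (y * q ^ n) q (k + 1))
       = rogers_term q y (q ^ n) k"
proof -
  have "qpoch q q n / qpoch q q (n - k) * q ^ (k * (k - 1) div 2) = (\<Prod>j<k. q ^ j - q ^ n)"
    using assms(2)
  proof (induction k)
    case 0
    then show ?case using qpoch_self_nonzero[OF assms(1)] by simp
  next
    case (Suc k)
    then obtain m where m: "n = Suc (k + m)" using less_eqE[of "Suc k" n] by auto
    have "qpoch q q (Suc m) = qpoch q q m * (1 - q * q ^ m)" by (rule qpoch_Suc)
    then have "qpoch q q n / qpoch q q m = qpoch q q n / qpoch q q (Suc m) * (1 - q * q ^ m)"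
      using qpoch_self_nonzero[OF assms(1), of "Suc m"] by auto
    then have "qpoch q q n / qpoch q q m * q ^ (k * (k - 1) div 2 + k)
        = (qpoch q q n / qpoch q q (Suc m) * q ^ (k * (k - 1) div 2)) * (q ^ k - q ^ n)"
      by (simp add: m power_add algebra_simps)
    with Suc.IH show ?case unfolding theta_index_Suc by (simp add: m Suc_diff_le)
  qed
  from this[symmetric] show ?thesis
    using qpoch_self_nonzero[OF assms(1), of k] by (simp add: rogers_term_def qbinom_def mult_ac)
qed

section \<open>Theta series, infinite products and the limit of (b)\<close>

lemma summable_theta:
  fixes x q :: complex
  assumes "norm q < 1"
  shows "summable (\<lambda>k. norm (x ^ k * q ^ (k * (k - 1) div 2)))"
proof -
  \<comment> \<open>The ratio of consecutive terms is x q^k, which tends to 0 for every x.\<close>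
  have "(\<lambda>k. norm x * norm q ^ k) \<longlonglongrightarrow> norm x * 0"
    using assms by (intro tendsto_intros LIMSEQ_power_zero) auto
  then have "eventually (\<lambda>k. norm x * norm q ^ k < 1 / 2) sequentially"
    by (rule order_tendstoD) simp
  then obtain N where N: "\<And>k. k \<ge> N \<Longrightarrow> norm x * norm q ^ k < 1 / 2"
    by (auto simp: eventually_sequentially)
  show ?thesis
  proof (rule summable_ratio_test[of "1 / 2" N])
    fix k assume "k \<ge> N"
    then have "norm x * norm q ^ k * norm (x ^ k * q ^ (k * (k - 1) div 2)) \<le> 1 / 2 * norm (x ^ k * q ^ (k * (k - 1) div 2))"
      using N[of k] by (intro mult_right_mono) auto
    then show "norm (norm (x ^ Suc k * q ^ (Suc k * (Suc k - 1) div 2))) \<le> 1 / 2 * norm (norm (x ^ k * q ^ (k * (k - 1) div 2)))"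
      unfolding theta_index_Suc by (simp add: norm_mult norm_power power_add mult_ac)
  qed simp
qed

lemma isCont_theta:
  fixes q :: complex
  assumes "norm q < 1"
  shows "isCont (\<lambda>x. \<Sum>k. x ^ k * q ^ (k * (k - 1) div 2)) y"
  using isCont_powser_converges_everywhere[of "\<lambda>k. q ^ (k * (k - 1) div 2)" y]
    summable_norm_cancel[OF summable_theta[OF assms]] by (simp add: mult.commute)

lemma isCont_qpoch: "isCont g y \<Longrightarrow> isCont (\<lambda>z. qpoch (g z) p n) y"
  unfolding qpoch_def by (intro continuous_intros)

lemma convergent_prod_qpoch:
  fixes p :: complex
  assumes "norm p < 1"
  shows "convergent_prod (\<lambda>i. 1 - x * p ^ i)"
proof (rule abs_convergent_prod_imp_convergent_prod, rule summable_imp_abs_convergent_prod)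
  show "summable (\<lambda>i. norm (1 - x * p ^ i - 1))"
    using assms by (simp add: norm_mult norm_power summable_mult summable_geometric)
qed

lemma qpoch_LIMSEQ:
  assumes "norm p < 1"
  shows "qpoch x p \<longlonglongrightarrow> qpoch_inf x p"
proof -
  have "(\<lambda>n. qpoch x p (Suc n)) \<longlonglongrightarrow> qpoch_inf x p"
    using convergent_prod_LIMSEQ[OF convergent_prod_qpoch[OF assms, of x]]
    by (simp add: qpoch_def qpoch_inf_def lessThan_Suc_atMost del: prod.lessThan_Suc)
  then show ?thesis by (rule LIMSEQ_imp_Suc)
qed

lemma qpoch_inf_nonzero:
  assumes "norm p < 1" "\<And>i. x * p ^ i \<noteq> 1"
  shows "qpoch_inf x p \<noteq> 0"
  unfolding qpoch_inf_def
  by (rule prodinf_nonzero[OF convergent_prod_qpoch[OF assms(1)]]) (use assms(2) in auto)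

lemma qpoch_inf_split:
  assumes "norm p < 1"
  shows "qpoch_inf x p = qpoch x p m * qpoch_inf (x * p ^ m) p"
proof (rule LIMSEQ_unique)
  show "(\<lambda>n. qpoch x p (n + m)) \<longlonglongrightarrow> qpoch_inf x p"
    by (rule LIMSEQ_ignore_initial_segment[OF qpoch_LIMSEQ[OF assms]])
  show "(\<lambda>n. qpoch x p (n + m)) \<longlonglongrightarrow> qpoch x p m * qpoch_inf (x * p ^ m) p"
    unfolding add.commute[of _ m] qpoch_add by (intro tendsto_intros qpoch_LIMSEQ assms)
qed

text \<open>Combine (q;q)_{2n} = (q;q^2)_n (q^2;q^2)_n with (q^2;q^2)_n = (q;q)_n (-q;q)_n, let n
  tend to infinity and cancel (q;q)_inf.\<close>

lemma qpoch_inf_euler: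
  assumes "norm q < 1"
  shows "qpoch_inf (- q) q * qpoch_inf q (q\<^sup>2) = 1"
proof -
  have q2: "norm (q\<^sup>2) < 1" using assms by (simp add: norm_power power_less_one_iff)
  have "qpoch q q n * (qpoch (- q) q n * qpoch q (q\<^sup>2) n) = qpoch q q (2 * n)" for n
    using qpoch_double[of q q n] qpoch_square[of q q n] by (simp add: power2_eq_square mult_ac)
  moreover have lim: "(\<lambda>n. qpoch q q n * (qpoch (- q) q n * qpoch q (q\<^sup>2) n))
      \<longlonglongrightarrow> qpoch_inf q q * (qpoch_inf (- q) q * qpoch_inf q (q\<^sup>2))"
    by (intro tendsto_intros qpoch_LIMSEQ assms q2)
  moreover have "(\<lambda>n. qpoch q q (2 * n)) \<longlonglongrightarrow> qpoch_inf q q"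
    by (rule filterlim_compose[OF qpoch_LIMSEQ[OF assms]])
      (simp add: filterlim_subseq strict_mono_def)
  ultimately have "qpoch_inf q q * (qpoch_inf (- q) q * qpoch_inf q (q\<^sup>2)) = qpoch_inf q q"
    using LIMSEQ_unique[OF lim] by simp
  moreover have "qpoch_inf q q \<noteq> 0"
    using power_ne_one[OF assms, of "Suc _"] by (intro qpoch_inf_nonzero assms) simp
  ultimately show ?thesis by simp
qed

text \<open>A majorant independent of n, as Tannery's theorem requires. For k < n the numerator
  factor is at most 2 |q|^k and each denominator factor at least 1/2, so one step costs at most 4
  |z| |q|^k; the leading 2 bounds the term k = 0. Beyond k = n the terms vanish.\<close>

lemma rogers_term_bound:
  assumes q: "norm q < 1" and n: "norm (z * q ^ n) \<le> 1 / 2"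
  shows "norm (rogers_term q z (q ^ n) k) \<le> 2 * norm ((4 * z) ^ k * q ^ (k * (k - 1) div 2))"
proof -
  have den: "1 / 2 \<le> norm (1 - z * q ^ n * q ^ i)" for i
  proof -
    have "norm (z * q ^ n * q ^ i) = norm (z * q ^ n) * norm q ^ i"
      by (simp add: norm_mult norm_power)
    also have "\<dots> \<le> 1 / 2 * 1"
      using q n by (intro mult_mono) (auto intro: power_le_one)
    finally show ?thesis using norm_triangle_ineq2[of 1 "z * q ^ n * q ^ i"] by simp
  qed
  show ?thesis
  proof (induction k)
    case 0
    show ?case using den[of 0] by (simp add: rogers_term_def qpoch_Suc norm_divide divide_simps)
  next
    case (Suc k)
    show ?case
    proof (cases "k < n")
      case True
      have "norm (q ^ n) \<le> norm q ^ k"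
        unfolding norm_power using q True by (intro power_decreasing) auto
      then have num: "norm (q ^ k - q ^ n) \<le> 2 * norm q ^ k"
        using norm_triangle_ineq4[of "q ^ k" "q ^ n"] by (simp add: norm_power)
      have "norm (z * (q ^ k - q ^ n) / (1 - z * q ^ n * q ^ Suc k))
          \<le> norm z * (2 * norm q ^ k) / (1 / 2)"
        unfolding norm_divide norm_mult by (intro frac_le mult_mono num den) auto
      with Suc.IH have "norm (rogers_term q z (q ^ n) (Suc k))
          \<le> (2 * norm ((4 * z) ^ k * q ^ (k * (k - 1) div 2))) * (norm z * (2 * norm q ^ k) / (1 / 2))"
        unfolding rogers_term_Suc norm_mult[of "rogers_term q z (q ^ n) k"] by (intro mult_mono) auto
      also have "\<dots> = 2 * norm ((4 * z) ^ Suc k * q ^ (Suc k * (Suc k - 1) div 2))"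
        unfolding theta_index_Suc by (simp add: norm_mult norm_power power_add mult_ac)
      finally show ?thesis .
    qed (simp add: rogers_term_eq_0)
  qed
qed

lemma rogers_term_LIMSEQ:
  assumes "norm q < 1"
  shows "(\<lambda>n. rogers_term q z (q ^ n) k) \<longlonglongrightarrow> z ^ k * q ^ (k * (k - 1) div 2)"
proof -
  have q0: "(\<lambda>n. q ^ n) \<longlonglongrightarrow> 0" using assms by (rule LIMSEQ_power_zero)
  have "(\<Prod>j<k. q ^ j - 0) = q ^ (k * (k - 1) div 2)"
  proof (induction k)
    case (Suc k)
    then show ?case unfolding theta_index_Suc by (simp add: power_add)
  qed simp
  moreover have "(\<lambda>n. rogers_term q z (q ^ n) k) \<longlonglongrightarrow> z ^ k * (\<Prod>j<k. q ^ j - 0) / (\<Prod>i<Suc k. 1 - z * 0 * q ^ i)"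
    unfolding rogers_term_def qpoch_def by (intro tendsto_intros q0) simp
  ultimately show ?thesis by simp
qed

lemma rogers_sum_LIMSEQ:
  assumes "norm q < 1"
  shows "(\<lambda>n. \<Sum>k\<le>n. rogers_term q z (q ^ n) k) \<longlonglongrightarrow> (\<Sum>k. z ^ k * q ^ (k * (k - 1) div 2))"
proof -
  have "(\<lambda>n. norm (z * q ^ n)) \<longlonglongrightarrow> norm (z * 0)"
    using assms by (intro tendsto_intros LIMSEQ_power_zero)
  then have "eventually (\<lambda>n. norm (z * q ^ n) < 1 / 2) sequentially"
    by (rule order_tendstoD) simp
  \<comment> \<open>The bound holds for all k at once as soon as n is large, so the condition on k
    in the product filter is trivial.\<close>
  then have "eventually (\<lambda>(k, n). norm (rogers_term q z (q ^ n) k) \<le> 2 * norm ((4 * z) ^ k * q ^ (k * (k - 1) div 2)))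
      (at_top \<times>\<^sub>F sequentially)"
    unfolding eventually_prod_filter
    using rogers_term_bound[OF assms, of z] less_imp_le
    by (intro exI[of _ "\<lambda>_. True"] exI[of _ "\<lambda>n. norm (z * q ^ n) < 1 / 2"]) auto
  then have "(\<lambda>n. \<Sum>k. rogers_term q z (q ^ n) k) \<longlonglongrightarrow> (\<Sum>k. z ^ k * q ^ (k * (k - 1) div 2))"
    using tannerys_theorem[where a = "\<lambda>k n. rogers_term q z (q ^ n) k", OF rogers_term_LIMSEQ[OF assms] _ summable_mult[OF summable_theta[OF assms]]]
      sequentially_bot by blast
  moreover have "(\<Sum>k. rogers_term q z (q ^ n) k) = (\<Sum>k\<le>n. rogers_term q z (q ^ n) k)" for n
    by (rule suminf_finite) (auto simp: rogers_term_eq_0)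
  ultimately show ?thesis by simp
qed

section \<open>The identities (a), (b), (c) at generic points\<close>

text \<open>Excluding z = q^(-m) and z = -q^(-m) keeps (z;q)_n and (z^2;q^2)_n = (z;q)_n (-z;q)_n
  away from 0, so the literal quotients have their intended values.\<close>

locale qpoch_generic =
  fixes q z :: complex
  assumes q: "q \<noteq> 0" "norm q < 1"
    and z: "\<And>m. z * q ^ m \<noteq> 1" "\<And>m. z * q ^ m \<noteq> -1"
begin

lemma q2: "norm (q\<^sup>2) < 1"
  using q by (simp add: norm_power power_less_one_iff)

lemma minus_z: "- z * q ^ m \<noteq> 1"
  using z(2)[of m] by (metis minus_minus mult_minus_left)

lemma nonzero: "qpoch (q\<^sup>2) (q\<^sup>2) n \<noteq> 0" "qpoch z q n \<noteq> 0" "qpoch (- z) q n \<noteq> 0" "qpoch (z\<^sup>2) (q\<^sup>2) n \<noteq> 0"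
  using qpoch_self_nonzero[OF q2] z(1) minus_z unfolding qpoch_square mult_eq_0_iff qpoch_eq_0_iff by blast+

text \<open>Isolates the factor (z;q)_{2n+1} of the new summand: for (a) it splits as (z;q)_{n+1} (z
  q^(n+1);q)_n, for (b) it cancels against the prefactor.\<close>

lemma numerator: "qpoch (z / q) q (2 * Suc n) = (1 - z / q) * qpoch z q (2 * n + 1)"
  using q(1) by (simp add: qpoch_Suc_left)

lemma generic_a:
  "(\<Sum>k\<le>n. q ^ k * (qpoch (z * q ^ n) q k / qpoch (q\<^sup>2) (q\<^sup>2) k)) =
     qpoch (- z) q n * (\<Sum>k\<le>n. q ^ k * (qpoch (z / q) q (2 * k) / (qpoch (q\<^sup>2) (q\<^sup>2) k * qpoch (z\<^sup>2) (q\<^sup>2) k)))"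
proof (induction n)
  case (Suc n)
  have "qpoch z q (2 * n + 1) = qpoch z q (Suc n) * qpoch (z * q ^ Suc n) q n"
    using qpoch_add[of z q "Suc n" n] by (simp add: mult_2)
  \<comment> \<open>Here (z^2;q^2)_{n+1} absorbs both the prefactor (-z;q)_{n+1} and (z;q)_{n+1},
    leaving the closed form of \<open>sum_qpoch_telescope\<close>.\<close>
  then have new: "qpoch (- z) q (Suc n) * (q ^ Suc n * (qpoch (z / q) q (2 * Suc n) / (qpoch (q\<^sup>2) (q\<^sup>2) (Suc n) * qpoch (z\<^sup>2) (q\<^sup>2) (Suc n))))
      = q ^ Suc n * (1 - z / q) * qpoch (z * q ^ Suc n) q n / qpoch (q\<^sup>2) (q\<^sup>2) (Suc n)"
    using nonzero[of "Suc n"] unfolding numerator qpoch_square by (simp del: power_Suc)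
  have "q ^ Suc n * (1 - z / q) = q ^ Suc n - z * q ^ n"
    using q(1) by (simp add: field_simps)
  then show ?case
    using sum_qpoch_telescope[OF q(2), where w = "z * q ^ n" and N = n] Suc new
    unfolding sum.atMost_Suc[of "\<lambda>k. q ^ k * (qpoch (z / q) q (2 * k) / _ k)"] distrib_left new
    by (simp add: qpoch_Suc[of "-z"] algebra_simps)
qed simp

lemma generic_b:
  "(\<Sum>k\<le>n. rogers_term q z (q ^ n) k) =
     qpoch (q\<^sup>2) (q\<^sup>2) n * qpoch (z\<^sup>2) (q\<^sup>2) n / qpoch z q (2 * n + 1) *
     (\<Sum>k\<le>n. q ^ (2 * k) * (qpoch (z / q) q (2 * k) / (qpoch (q\<^sup>2) (q\<^sup>2) k * qpoch (z\<^sup>2) (q\<^sup>2) k)))"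
proof (induction n)
  case 0
  show ?case by (simp add: rogers_term_def)
next
  case (Suc n)
  define d where "d = (1 - z * q ^ (2 * n + 1)) * (1 - z * q ^ (2 * n + 2))"
  define e where "e = (1 - q ^ (2 * n + 2)) * (1 - z\<^sup>2 * q ^ (2 * n))"
  define c where "c n = qpoch (q\<^sup>2) (q\<^sup>2) n * qpoch (z\<^sup>2) (q\<^sup>2) n / qpoch z q (2 * n + 1)" for n
  define s where "s k = q ^ (2 * k) * (qpoch (z / q) q (2 * k) / (qpoch (q\<^sup>2) (q\<^sup>2) k * qpoch (z\<^sup>2) (q\<^sup>2) k))" for k
  have Z: "qpoch z q (2 * Suc n + 1) = qpoch z q (2 * n + 1) * d"
    by (simp add: qpoch_Suc d_def mult_ac)
  have d: "d \<noteq> 0" using nonzero(2)[of "2 * Suc n + 1"] unfolding Z by simp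
  have c: "d * c (Suc n) = e * c n"
  proof -
    have "e = (1 - q\<^sup>2 * (q\<^sup>2) ^ n) * (1 - z\<^sup>2 * (q\<^sup>2) ^ n)"
      by (simp add: e_def power_mult[symmetric] power_add[symmetric])
    then show ?thesis using d unfolding c_def Z qpoch_Suc by simp
  qed
  have s: "d * (c (Suc n) * s (Suc n)) = q ^ (2 * n + 1) * (q - z)"
    using nonzero[of "Suc n"] nonzero(2)[of "2 * n + 1"] d q(1) unfolding c_def s_def Z numerator
    by (simp add: field_simps)
  have "d * (\<Sum>k\<le>Suc n. rogers_term q z (q ^ Suc n) k) = e * (\<Sum>k\<le>n. rogers_term q z (q ^ n) k) + q ^ (2 * n + 1) * (q - z)"
    unfolding d_def e_def by (rule rogers_sum_rec[OF q(1) z(1)])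
  also have "\<dots> = e * (c n * (\<Sum>k\<le>n. s k)) + d * (c (Suc n) * s (Suc n))"
    unfolding s using Suc by (simp add: c_def s_def)
  also have "\<dots> = d * (c (Suc n) * (\<Sum>k\<le>Suc n. s k))"
    using c by (simp add: algebra_simps)
  finally have "(\<Sum>k\<le>Suc n. rogers_term q z (q ^ Suc n) k) = c (Suc n) * (\<Sum>k\<le>Suc n. s k)"
    by (simp only: mult_left_cancel[OF d])
  then show ?case unfolding c_def s_def .
qed

lemma generic_c:
  "(\<Sum>k. z ^ k * q ^ (k * (k - 1) div 2)) =
     qpoch_inf (q\<^sup>2) (q\<^sup>2) * qpoch_inf (- z) q * phi21 (z / q) z (z\<^sup>2) (q\<^sup>2) (q\<^sup>2)"
proof -
  define c where "c n = qpoch (q\<^sup>2) (q\<^sup>2) n * qpoch (z\<^sup>2) (q\<^sup>2) n / qpoch z q (2 * n + 1)" for n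
  define s where "s k = q ^ (2 * k) * (qpoch (z / q) q (2 * k) / (qpoch (q\<^sup>2) (q\<^sup>2) k * qpoch (z\<^sup>2) (q\<^sup>2) k))" for k
  define L where "L = qpoch_inf (q\<^sup>2) (q\<^sup>2) * qpoch_inf (- z) q"
  have z0: "qpoch_inf z q \<noteq> 0" using z(1) by (intro qpoch_inf_nonzero q)
  have "qpoch_inf (q\<^sup>2) (q\<^sup>2) \<noteq> 0"
    using power_ne_one[OF q2, of "Suc _"] by (intro qpoch_inf_nonzero q2) simp
  moreover have "qpoch_inf (- z) q \<noteq> 0" using minus_z by (intro qpoch_inf_nonzero q)
  ultimately have L0: "L \<noteq> 0" by (simp add: L_def)
  have "(\<lambda>n. qpoch z q (2 * n + 1)) \<longlonglongrightarrow> qpoch_inf z q"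
    by (rule filterlim_compose[OF qpoch_LIMSEQ[OF q(2)]])
      (simp add: filterlim_subseq strict_mono_def)
  \<comment> \<open>By (z^2;q^2)_n = (z;q)_n (-z;q)_n, the limit (z;q)_inf of the denominator
    cancels.\<close>
  then have "c \<longlonglongrightarrow> qpoch_inf (q\<^sup>2) (q\<^sup>2) * (qpoch_inf z q * qpoch_inf (- z) q) / qpoch_inf z q"
    unfolding c_def qpoch_square[of z] by (intro tendsto_intros qpoch_LIMSEQ q q2 z0)
  then have c: "c \<longlonglongrightarrow> L" using z0 by (simp add: L_def)
  have c0: "c n \<noteq> 0" for n using nonzero by (simp add: c_def)
  \<comment> \<open>Dividing (b) by its prefactor gives the partial sums of the 2phi1 series, so its
    convergence and its value come out together.\<close>
  have "(\<lambda>n. c n * (\<Sum>k\<le>n. s k) / c n) \<longlonglongrightarrow> (\<Sum>k. z ^ k * q ^ (k * (k - 1) div 2)) / L"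
    using rogers_sum_LIMSEQ[OF q(2), of z] unfolding generic_b c_def[symmetric] s_def[symmetric]
    by (intro tendsto_divide c L0)
  then have "s sums ((\<Sum>k. z ^ k * q ^ (k * (k - 1) div 2)) / L)"
    using c0 by (simp add: sums_def_le)
  then have "(\<Sum>k. z ^ k * q ^ (k * (k - 1) div 2)) = L * suminf s"
    using L0 by (simp add: sums_unique[symmetric])
  also have "suminf s = phi21 (z / q) z (z\<^sup>2) (q\<^sup>2) (q\<^sup>2)"
    using q(1) unfolding phi21_def s_def
    by (intro arg_cong[where f = suminf] ext) (simp add: qpoch_double power_mult)
  finally show ?thesis by (simp add: L_def)
qed

end

section \<open>Extension to the removed points, and the special case (d)\<close>

lemma eventually_qpoch_generic:
  assumes "q \<noteq> 0" "norm q < 1"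
  shows "eventually (qpoch_generic q) (at y)"
proof -
  \<comment> \<open>Within distance 1 of y, |z q^m| < 1 for all m >= M, so only the finitely many
    exceptional points with m < M, collected in \<open>B\<close>, have to be avoided.\<close>
  have "(\<lambda>m. (norm y + 1) * norm q ^ m) \<longlonglongrightarrow> (norm y + 1) * 0"
    using assms by (intro tendsto_intros LIMSEQ_power_zero) auto
  then have "eventually (\<lambda>m. (norm y + 1) * norm q ^ m < 1) sequentially"
    by (rule order_tendstoD) simp
  then obtain M where M: "\<And>m. m \<ge> M \<Longrightarrow> (norm y + 1) * norm q ^ m < 1"
    by (auto simp: eventually_sequentially)
  define B where "B = (\<lambda>m. 1 / q ^ m) ` {..<M} \<union> (\<lambda>m. - 1 / q ^ m) ` {..<M}"
  have "finite B" by (simp add: B_def)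
  then have "eventually (\<lambda>z. z \<notin> B) (at y)"
    by (metis eventually_at_topological islimpt_finite islimpt_iff_eventually)
  moreover have "eventually (\<lambda>z. dist z y < 1) (at y)"
    by (auto simp: eventually_at intro: exI[of _ 1])
  ultimately show ?thesis
  proof eventually_elim
    case (elim z)
    have "norm z \<le> norm y + 1" using elim(2) norm_triangle_ineq2[of z y] by (simp add: dist_norm)
    then have small: "norm (z * q ^ m) < 1" if "m \<ge> M" for m
      using M[OF that] mult_right_mono[of "norm z" "norm y + 1" "norm q ^ m"]
      by (simp add: norm_mult norm_power)
    have "z * q ^ m \<noteq> 1 \<and> z * q ^ m \<noteq> -1" for m
    proof (cases "m < M")
      case True
      then have "z \<noteq> 1 / q ^ m" "z \<noteq> - 1 / q ^ m" using elim(1) by (auto simp: B_def)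
      then show ?thesis using assms(1) by (simp add: field_simps)
    next
      case False
      then show ?thesis using small[of m] by (metis less_irrefl norm_minus_cancel norm_one not_le_imp_less)
    qed
    then show ?case using assms by (simp add: qpoch_generic_def)
  qed
qed

text \<open>Near y, with y itself left out, every point is generic, so F agrees there with the
  continuous f and has limit f y at y. That limit is the value of
  \<open>remove_sings\<close>.\<close>

lemma remove_sings_eq_generic:
  assumes "q \<noteq> 0" "norm q < 1" "isCont f y" "\<And>z. qpoch_generic q z \<Longrightarrow> f z = F z"
  shows "f y = remove_sings F y"
proof (rule sym, rule remove_sings_eqI)
  show "F \<midarrow>y\<rightarrow> f y"
    using assms(3) eventually_mono[OF eventually_qpoch_generic[OF assms(1,2)] assms(4)]
    unfolding isCont_def by (rule Lim_transform_eventually)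
qed

text \<open>The point z = q^(2r+1) is generic since |z q^m| < 1 for all m, so (c) holds there
  literally. The prefactor simplifies because (-q;q)_{2r} (-z;q)_inf = (-q;q)_inf, which is 1 /
  (q;q^2)_inf by Euler.\<close>

lemma theta_odd_power:
  fixes q :: complex
  assumes "q \<noteq> 0" "norm q < 1"
  shows "qpoch (- q) q (2 * r) * (\<Sum>k. q ^ (k * (k + 1) div 2 + 2 * r * k)) =
        qpoch_inf (q\<^sup>2) (q\<^sup>2) / qpoch_inf q (q\<^sup>2) *
          (\<Sum>k. q ^ (2 * k) * (qpoch (q ^ (2 * r)) q (2 * k) /
             (qpoch (q\<^sup>2) (q\<^sup>2) k * qpoch (q ^ (4 * r + 2)) (q\<^sup>2) k)))"
proof -
  define z where "z = q ^ (2 * r + 1)"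
  have small: "norm (z * q ^ m) < 1" for m
  proof -
    have "z * q ^ m = q ^ (2 * r + 1 + m)" by (simp only: z_def power_add)
    then show ?thesis using assms(2) by (simp only: norm_power) (simp add: power_less_one_iff del: power_Suc)
  qed
  interpret qpoch_generic q z
    using assms small by unfold_locales (metis less_irrefl norm_minus_cancel norm_one)+
  have "k * (k + 1) div 2 = k * (k - 1) div 2 + k" for k :: nat
    using theta_index_Suc[of k] by (simp add: mult.commute)
  then have "z ^ k * q ^ (k * (k - 1) div 2) = q ^ (k * (k + 1) div 2 + 2 * r * k)" for k
    by (simp add: z_def power_mult[symmetric] power_add[symmetric] algebra_simps)
  then have lhs: "(\<Sum>k. q ^ (k * (k + 1) div 2 + 2 * r * k)) = (\<Sum>k. z ^ k * q ^ (k * (k - 1) div 2))"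
    by simp
  have zs: "z / q = q ^ (2 * r)" "z\<^sup>2 = q ^ (4 * r + 2)" "z = z / q * q" "- q * q ^ (2 * r) = - z"
    using assms(1) by (simp_all add: z_def power_mult[symmetric] power2_eq_square power_add[symmetric])
  have phi: "phi21 (z / q) z (z\<^sup>2) (q\<^sup>2) (q\<^sup>2) = (\<Sum>k. q ^ (2 * k) * (qpoch (q ^ (2 * r)) q (2 * k) /
             (qpoch (q\<^sup>2) (q\<^sup>2) k * qpoch (q ^ (4 * r + 2)) (q\<^sup>2) k)))"
    unfolding phi21_def zs(1,2)[symmetric] unfolding qpoch_double zs(3)[symmetric] power_mult[of q 2]
    by (simp add: mult_ac)
  have "qpoch (- q) q (2 * r) * qpoch_inf (- z) q = qpoch_inf (- q) q"
    using qpoch_inf_split[OF assms(2), of "- q" "2 * r"] unfolding zs(4) by simp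
  also have "\<dots> = 1 / qpoch_inf q (q\<^sup>2)"
    using qpoch_inf_euler[OF assms(2)] by (metis eq_divide_eq mult_zero_right zero_neq_one)
  finally have prefactor: "qpoch (- q) q (2 * r) * qpoch_inf (- z) q = 1 / qpoch_inf q (q\<^sup>2)" .
  have regroup: "A * (B * C * D) = B / E * D" if "A * C = 1 / E" for A B C D E :: complex
  proof -
    have "A * (B * C * D) = B * (A * C) * D" by (simp add: mult_ac)
    then show ?thesis using that by simp
  qed
  show ?thesis unfolding lhs generic_c phi by (rule regroup[OF prefactor])
qed

theorem theorem1p3:
  fixes q :: complex
  assumes "0 < norm q" and "norm q < 1"
  shows
    "(\<forall>y::complex. (\<forall>m::nat. y \<noteq> - (1 / q ^ m)) \<longrightarrow>
        (\<forall>n::nat.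
           (\<Sum>k=0..n. q ^ k * (qpoch (y * q ^ n) q k / qpoch (q\<^sup>2) (q\<^sup>2) k)) =
           remove_sings (\<lambda>z. qpoch (- z) q n *
             (\<Sum>k=0..n. q ^ k * (qpoch (z / q) q (2 * k) /
                (qpoch (q\<^sup>2) (q\<^sup>2) k * qpoch (z\<^sup>2) (q\<^sup>2) k)))) y)
      \<and> (\<forall>n::nat. (\<forall>k\<le>n. qpoch (y * q ^ n) q (k + 1) \<noteq> 0) \<longrightarrow>
           (\<Sum>k=0..n. qbinom q n k * y ^ k * q ^ (k * (k - 1) div 2) *
              (qpoch q q k / qpoch (y * q ^ n) q (k + 1))) =
           remove_sings (\<lambda>z. qpoch (q\<^sup>2) (q\<^sup>2) n * qpoch (z\<^sup>2) (q\<^sup>2) n / qpoch z q (2 * n + 1) *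
             (\<Sum>k=0..n. q ^ (2 * k) * (qpoch (z / q) q (2 * k) /
                (qpoch (q\<^sup>2) (q\<^sup>2) k * qpoch (z\<^sup>2) (q\<^sup>2) k)))) y)
      \<and> (\<Sum>k. y ^ k * q ^ (k * (k - 1) div 2)) =
           remove_sings (\<lambda>z. qpoch_inf (q\<^sup>2) (q\<^sup>2) * qpoch_inf (- z) q *
             phi21 (z / q) z (z\<^sup>2) (q\<^sup>2) (q\<^sup>2)) y)
   \<and> (\<forall>r::nat.
        qpoch (- q) q (2 * r) * (\<Sum>k. q ^ (k * (k + 1) div 2 + 2 * r * k)) =
        qpoch_inf (q\<^sup>2) (q\<^sup>2) / qpoch_inf q (q\<^sup>2) *
          (\<Sum>k. q ^ (2 * k) * (qpoch (q ^ (2 * r)) q (2 * k) /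
             (qpoch (q\<^sup>2) (q\<^sup>2) k * qpoch (q ^ (4 * r + 2)) (q\<^sup>2) k))))"
proof -
  from assms have q: "q \<noteq> 0" by auto
  note extend = remove_sings_eq_generic[OF q assms(2)]
  have a: "(\<Sum>k=0..n. q ^ k * (qpoch (y * q ^ n) q k / qpoch (q\<^sup>2) (q\<^sup>2) k)) =
           remove_sings (\<lambda>z. qpoch (- z) q n *
             (\<Sum>k=0..n. q ^ k * (qpoch (z / q) q (2 * k) /
                (qpoch (q\<^sup>2) (q\<^sup>2) k * qpoch (z\<^sup>2) (q\<^sup>2) k)))) y" for y n
  proof (rule extend)
    \<comment> \<open>The left-hand side of (a) is a polynomial in y, its denominators being nonzero
      constants.\<close>
    have "qpoch (q\<^sup>2) (q\<^sup>2) k \<noteq> 0" for k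
      using assms by (intro qpoch_self_nonzero) (simp add: norm_power power_less_one_iff)
    then show "isCont (\<lambda>z. \<Sum>k=0..n. q ^ k * (qpoch (z * q ^ n) q k / qpoch (q\<^sup>2) (q\<^sup>2) k)) y"
      by (intro continuous_intros isCont_qpoch) auto
  qed (simp only: atLeast0AtMost qpoch_generic.generic_a)
  have b: "(\<Sum>k=0..n. qbinom q n k * y ^ k * q ^ (k * (k - 1) div 2) *
              (qpoch q q k / qpoch (y * q ^ n) q (k + 1))) =
           remove_sings (\<lambda>z. qpoch (q\<^sup>2) (q\<^sup>2) n * qpoch (z\<^sup>2) (q\<^sup>2) n / qpoch z q (2 * n + 1) *
             (\<Sum>k=0..n. q ^ (2 * k) * (qpoch (z / q) q (2 * k) /
                (qpoch (q\<^sup>2) (q\<^sup>2) k * qpoch (z\<^sup>2) (q\<^sup>2) k)))) y"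
    if "\<forall>k\<le>n. qpoch (y * q ^ n) q (k + 1) \<noteq> 0" for y n
  proof (rule extend)
    show "isCont (\<lambda>z. \<Sum>k=0..n. qbinom q n k * z ^ k * q ^ (k * (k - 1) div 2) *
              (qpoch q q k / qpoch (z * q ^ n) q (k + 1))) y"
      \<comment> \<open>The assumption excludes y = q^(-m) with n <= m <= 2n, where a denominator on
        the left of (b) vanishes.\<close>
      using that by (intro continuous_intros isCont_qpoch) auto
  qed (simp only: atLeast0AtMost qpoch_generic.generic_b[symmetric],
      intro sum.cong refl, simp only: atMost_iff qbinom_eq_rogers_term[OF assms(2)])
  have c: "(\<Sum>k. y ^ k * q ^ (k * (k - 1) div 2)) =
           remove_sings (\<lambda>z. qpoch_inf (q\<^sup>2) (q\<^sup>2) * qpoch_inf (- z) q *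
             phi21 (z / q) z (z\<^sup>2) (q\<^sup>2) (q\<^sup>2)) y" for y
    by (rule extend[OF isCont_theta[OF assms(2)] qpoch_generic.generic_c])
  show ?thesis
    using a b c theta_odd_power[OF q assms(2)] by blast
qed

end
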